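(* Let $\{F_\theta:\theta\in\Theta\}$ be a standard exponential family generated by $F_0$, with $\Theta=[0,\theta_{\max})$, and for $\theta\in\Theta$ let $X_1,X_2,\dots$ be i.i.d. with law $F_\theta$ under $\mathbb{P}_\theta$. Let $C>0$, $r>0$, $\theta^\ast>0$ with $[0,\theta^\ast]\subset\Theta$ be constants such that for all $b>0$ and $y>0$ $$\sup_{\theta\in[0,\theta^\ast]}\bigl|\mathbb{P}_\theta(R_b\le y)-\mathbb{P}_\theta(R_\infty\le y)\bigr|\le C e^{-r(b+y)} .$$ Then for all $b>0$ $$\sup_{\theta\in[0,\theta^\ast]}W_1(R_b,R_\infty)\ \le\ \frac{C}{r}\,e^{-rb},$$ where for each $\theta$ the distance $W_1(R_b,R_\infty)$ is computed between the laws of $R_b$ and $R_\infty$ under $\mathbb{P}_\theta$.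
   Context: Standard exponential family: $F_0$ is a probability measure on $\mathbb{R}$ and $\Theta=[0,\theta_{\max})$, $\theta_{\max}\in(0,\infty]$, is such that $\int e^{\theta x}F_0(dx)<\infty$ for all $\theta\in\Theta$. Put $\psi(\theta)=\ln\int e^{\theta x}F_0(dx)$ and $F_\theta(dx)=e^{\theta x-\psi(\theta)}F_0(dx)$. The family $\{F_\theta\}$ is called standard if, for $X\sim F_0$, $\mathbb{E}[X]=0$ and $\mathrm{Var}(X)=1$, and $F_0$ is strongly non-lattice, i.e. $\limsup_{|t|\to\infty}\left|\int e^{itx}F_0(dx)\right|<1$. $\mathbb{P}_\theta,\mathbb{E}_\theta$ denote probability and expectation when $X_1,X_2,\dots$ are i.i.d. with law $F_\theta$. $S_0=0$, $S_n=X_1+\dots+X_n$. For $b\ge 0$: $\tau(b)=\inf\{n\ge1:S_n>b\}$ and the overshoot is $R_b=S_{\tau(b)}-b$. $R_\infty$ denotes a nonnegative random variable whose law under $\mathbb{P}_\theta$ is the weak limit of the law of $R_b$ under $\mathbb{P}_\theta$ as $b\to\infty$ (this limit is known to exist). It is a known result from the literature that constants $C,r,\theta^\ast$ with the assumed uniform estimate exist for every standard exponential family. For real random variables $X,Y$ with finite first moments, $W_1(X,Y)=\inf\{\mathbb{E}|X'-Y'|: X'\stackrel{d}{=}X,\ Y'\stackrel{d}{=}Y\}$, the infimum over all joint constructions (couplings) $(X',Y')$. *)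

theory Defs
  imports "HOL-Probability.Probability"
begin

section \<open>Standard exponential families\<close>

definition parameter_set :: "ereal \<Rightarrow> real set" where
  "parameter_set \<theta>max = {\<theta>. 0 \<le> \<theta> \<and> ereal \<theta> < \<theta>max}"

definition cumulant :: "real measure \<Rightarrow> real \<Rightarrow> real" where
  "cumulant F0 \<theta> = ln (\<integral>x. exp (\<theta> * x) \<partial>F0)"

definition exp_tilt :: "real measure \<Rightarrow> real \<Rightarrow> real measure" where
  "exp_tilt F0 \<theta> = density F0 (\<lambda>x. ennreal (exp (\<theta> * x - cumulant F0 \<theta>)))"

text \<open>On the reals, \<^const>\<open>at_infinity\<close> is the filter \<open>\<bar>t\<bar> \<rightarrow> \<infinity>\<close>.\<close>

definition strongly_nonlattice :: "real measure \<Rightarrow> bool" where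
  "strongly_nonlattice F \<longleftrightarrow> Limsup at_infinity (\<lambda>t. ereal (cmod (char F t))) < 1"

text \<open>Integrability is required separately because the Bochner integral of a
  non-integrable function is 0.\<close>

definition standard_exp_family :: "real measure \<Rightarrow> ereal \<Rightarrow> bool" where
  "standard_exp_family F0 \<theta>max \<longleftrightarrow>
     real_distribution F0 \<and> 0 < \<theta>max \<and>
     (\<forall>\<theta>\<in>parameter_set \<theta>max. integrable F0 (\<lambda>x. exp (\<theta> * x))) \<and>
     integrable F0 (\<lambda>x. x) \<and> integrable F0 (\<lambda>x. x\<^sup>2) \<and>
     prob_space.expectation F0 (\<lambda>x. x) = 0 \<and> prob_space.variance F0 (\<lambda>x. x) = 1 \<and>
     strongly_nonlattice F0"

section \<open>Random walks and overshoots\<close>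

text \<open>The increments are indexed from 1; \<open>X 0\<close> is never used.\<close>

definition iid_with_law :: "'a measure \<Rightarrow> (nat \<Rightarrow> 'a \<Rightarrow> real) \<Rightarrow> real measure \<Rightarrow> bool" where
  "iid_with_law P X F \<longleftrightarrow>
     prob_space P \<and> prob_space.indep_vars P (\<lambda>_. borel) X {1..} \<and>
     (\<forall>i\<ge>1. distr P borel (X i) = F)"

definition partial_sum :: "(nat \<Rightarrow> 'a \<Rightarrow> real) \<Rightarrow> nat \<Rightarrow> 'a \<Rightarrow> real" where
  "partial_sum X n \<omega> = (\<Sum>i=1..n. X i \<omega>)"

text \<open>If the level is never exceeded, the infimum is that of the empty set of naturals,
  which is 0. For the walks considered here this happens with probability 0, since their
  steps are non-degenerate with nonnegative mean.\<close>

definition passage_time :: "(nat \<Rightarrow> 'a \<Rightarrow> real) \<Rightarrow> real \<Rightarrow> 'a \<Rightarrow> nat" where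
  "passage_time X b \<omega> = Inf {n. 1 \<le> n \<and> partial_sum X n \<omega> > b}"

definition overshoot :: "(nat \<Rightarrow> 'a \<Rightarrow> real) \<Rightarrow> real \<Rightarrow> 'a \<Rightarrow> real" where
  "overshoot X b \<omega> = partial_sum X (passage_time X b \<omega>) \<omega> - b"

abbreviation overshoot_law :: "'a measure \<Rightarrow> (nat \<Rightarrow> 'a \<Rightarrow> real) \<Rightarrow> real \<Rightarrow> real measure" where
  "overshoot_law P X b \<equiv> distr P borel (overshoot X b)"

text \<open>Weak convergence along the continuous parameter \<open>b \<rightarrow> \<infinity>\<close>, reduced to
  the library's sequential notion.\<close>

definition weak_limit_at_top :: "(real \<Rightarrow> real measure) \<Rightarrow> real measure \<Rightarrow> bool" where
  "weak_limit_at_top \<mu> \<nu> \<longleftrightarrow>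
     (\<forall>b. filterlim b at_top sequentially \<longrightarrow> weak_conv_m (\<lambda>n. \<mu> (b n)) \<nu>)"

definition limiting_overshoot_law ::
    "'a measure \<Rightarrow> (nat \<Rightarrow> 'a \<Rightarrow> real) \<Rightarrow> real measure \<Rightarrow> bool" where
  "limiting_overshoot_law P X \<nu> \<longleftrightarrow>
     real_distribution \<nu> \<and> (AE y in \<nu>. 0 \<le> y) \<and> weak_limit_at_top (overshoot_law P X) \<nu>"

section \<open>The Wasserstein distance of order 1\<close>

definition couplings :: "real measure \<Rightarrow> real measure \<Rightarrow> (real \<times> real) measure set" where
  "couplings \<mu> \<nu> = {\<pi>. prob_space \<pi> \<and> sets \<pi> = sets (borel \<Otimes>\<^sub>M borel) \<and>
     distr \<pi> borel fst = \<mu> \<and> distr \<pi> borel snd = \<nu>}"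

text \<open>A function of the two laws, with values in \<open>[0,\<infinity>]\<close>, so that it is
  meaningful without presupposing finite first moments.\<close>

definition W1 :: "real measure \<Rightarrow> real measure \<Rightarrow> ennreal" where
  "W1 \<mu> \<nu> = (INF \<pi>\<in>couplings \<mu> \<nu>. \<integral>\<^sup>+ z. ennreal \<bar>fst z - snd z\<bar> \<partial>\<pi>)"

end

theory Submission
  imports Defs
begin

text \<open>In dimension one the quantile coupling shows that \<open>W1 \<mu> \<nu>\<close> is at most
  \<open>\<integral> \<bar>F - G\<bar>\<close>, where \<open>F\<close> and \<open>G\<close> are the distribution functions of \<open>\<mu>\<close> and \<open>\<nu>\<close>, and integrating the
  assumed estimate over \<open>y > 0\<close> gives \<open>C / r * exp (- r * b)\<close>. It remains to see that \<open>F = G = 0\<close> on the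
  negative half-line, i.e. that almost surely every level is passed. Were the level \<open>b\<close> never passed
  with probability \<open>p > 0\<close>, then on this event all partial sums are at most \<open>b\<close>, so the
  formal overshoot of level \<open>n\<close> is at most \<open>b - n\<close>; a mass of at least \<open>p\<close> would escape
  to \<open>- \<infinity>\<close>, contradicting convergence to a law on \<open>[0, \<infinity>)\<close>.\<close>

text \<open>The quantile functions \<open>M.I\<close> and \<open>N.I\<close>, read on the same
  uniform variable, form a coupling whose cost is the area between their graphs. Slicing that area
  at height \<open>t\<close> instead of at \<open>u\<close> gives the set of \<open>u\<close>
  between the two distribution functions at \<open>t\<close>.\<close>

lemma W1_le_nn_integral_cdf:
  assumes "real_distribution \<mu>" and "real_distribution \<nu>"
  shows "W1 \<mu> \<nu> \<le> (\<integral>\<^sup>+ t. ennreal \<bar>cdf \<mu> t - cdf \<nu> t\<bar> \<partial>lborel)"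
proof -
  interpret M: cdf_distribution \<mu>
    using assms by (simp add: cdf_distribution_def)
  interpret N: cdf_distribution \<nu>
    using assms by (simp add: cdf_distribution_def)
  define U where "U = restrict_space lborel {0<..<1::real}"
  have U: "prob_space U"
    by (auto simp: U_def space_restrict_space emeasure_restrict_space intro!: prob_spaceI)
  interpret U: prob_space U by fact
  interpret LU: pair_sigma_finite lborel U ..
  have spU: "space U = {0<..<1}"
    by (simp add: U_def space_restrict_space)
  have sU: "sets U = sets (restrict_space borel {0<..<1::real})"
    by (simp add: U_def sets_restrict_space)
  have I_meas [measurable]: "M.I \<in> borel_measurable U" "N.I \<in> borel_measurable U"
    unfolding measurable_cong_sets[OF sU refl] by (rule M.measurable_CI N.measurable_CI)+
  define \<pi> where "\<pi> = distr U (borel \<Otimes>\<^sub>M borel) (\<lambda>u. (M.I u, N.I u))"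
  have "\<pi> \<in> couplings \<mu> \<nu>"
    using M.distr_I_eq_M N.distr_I_eq_M
    by (auto simp: couplings_def \<pi>_def distr_distr comp_def U_def[symmetric]
             intro!: U.prob_space_distr)
  then have "W1 \<mu> \<nu> \<le> (\<integral>\<^sup>+ z. ennreal \<bar>fst z - snd z\<bar> \<partial>\<pi>)"
    unfolding W1_def by (rule INF_lower)
  also have "\<dots> = (\<integral>\<^sup>+ u. ennreal \<bar>M.I u - N.I u\<bar> \<partial>U)"
    unfolding \<pi>_def by (subst nn_integral_distr) auto
  \<comment> \<open>The distance of two reals is the length of the interval between them; this
    supplies the second variable for Fubini.\<close>
  also have "\<dots> = (\<integral>\<^sup>+ u. (\<integral>\<^sup>+ t. indicator {min (M.I u) (N.I u)..<max (M.I u) (N.I u)} t \<partial>lborel) \<partial>U)"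
    by (intro nn_integral_cong) (auto simp: min_def max_def)
  also have "\<dots> = (\<integral>\<^sup>+ u. (\<integral>\<^sup>+ t. (if min (M.I u) (N.I u) \<le> t \<and> t < max (M.I u) (N.I u) then 1 else 0) \<partial>lborel) \<partial>U)"
    by (intro nn_integral_cong) (auto simp: indicator_def)
  also have "\<dots> = (\<integral>\<^sup>+ t. (\<integral>\<^sup>+ u. (if min (M.I u) (N.I u) \<le> t \<and> t < max (M.I u) (N.I u) then 1 else 0) \<partial>U) \<partial>lborel)"
    by (rule LU.Fubini') measurable
  also have "\<dots> = (\<integral>\<^sup>+ t. ennreal \<bar>cdf \<mu> t - cdf \<nu> t\<bar> \<partial>lborel)"
  proof (rule nn_integral_cong)
    fix t
    define a c where "a = min (cdf \<mu> t) (cdf \<nu> t)" and "c = max (cdf \<mu> t) (cdf \<nu> t)"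
    have ac: "0 \<le> a" "a \<le> c" "c \<le> 1"
      using M.cdf_nonneg N.cdf_nonneg M.cdf_bounded_prob N.cdf_bounded_prob
      by (auto simp: a_def c_def)
    have "(\<integral>\<^sup>+ u. (if min (M.I u) (N.I u) \<le> t \<and> t < max (M.I u) (N.I u) then 1 else 0) \<partial>U)
        = (\<integral>\<^sup>+ u. indicator {a<..c} u \<partial>U)"
    proof (rule nn_integral_cong)
      fix u assume "u \<in> space U"
      \<comment> \<open>The Galois connection between distribution function and quantile; its
        non-strict inequalities turn intervals closed on the left in \<open>t\<close> into intervals
        closed on the right in \<open>u\<close>.\<close>
      then have "u \<le> cdf \<mu> t \<longleftrightarrow> M.I u \<le> t" "u \<le> cdf \<nu> t \<longleftrightarrow> N.I u \<le> t"
        using M.pseudoinverse[of u t] N.pseudoinverse[of u t] by (auto simp: spU)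
      then show "(if min (M.I u) (N.I u) \<le> t \<and> t < max (M.I u) (N.I u) then 1 else 0)
          = (indicator {a<..c} u :: ennreal)"
        unfolding a_def c_def indicator_def min_le_iff_disj less_max_iff_disj le_max_iff_disj
          min_less_iff_disj greaterThanAtMost_iff
        by (auto simp: not_le[symmetric])
    qed
    also have "\<dots> = (\<integral>\<^sup>+ u. indicator {a<..c} u * indicator {0<..<1} u \<partial>lborel)"
      unfolding U_def by (subst nn_integral_restrict_space) auto
    also have "\<dots> = (\<integral>\<^sup>+ u. indicator {a<..c} u \<partial>lborel)"
    proof (rule nn_integral_cong_AE)
      \<comment> \<open>If \<open>c = 1\<close>, the point \<open>u = 1\<close> lies in the left set
        but outside the open unit interval; it is null.\<close>
      show "AE u in lborel. indicator {a<..c} u * indicator {0<..<1} u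
          = (indicator {a<..c} u :: ennreal)"
        using AE_lborel_singleton[of 1] ac
        by (auto elim!: eventually_mono simp: indicator_def)
    qed
    also have "\<dots> = ennreal \<bar>cdf \<mu> t - cdf \<nu> t\<bar>"
      using ac by (auto simp: a_def c_def max_def min_def)
    finally show "(\<integral>\<^sup>+ u. (if min (M.I u) (N.I u) \<le> t \<and> t < max (M.I u) (N.I u) then 1 else 0) \<partial>U)
        = ennreal \<bar>cdf \<mu> t - cdf \<nu> t\<bar>" .
  qed
  finally show ?thesis .
qed

lemma nn_integral_exp_neg_tail:
  fixes r b C :: real
  assumes "r > 0" and "C \<ge> 0"
  shows "(\<integral>\<^sup>+ y. ennreal (C * exp (- r * (b + y))) * indicator {0..} y \<partial>lborel)
    = ennreal (C / r * exp (- r * b))"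
proof -
  have "((\<lambda>y. - (C / r) * exp (- r * (b + y))) \<longlongrightarrow> - (C / r) * 0) at_top"
  proof (intro tendsto_intros filterlim_compose[OF exp_at_bot])
    show "filterlim (\<lambda>y. - r * (b + y)) at_bot at_top"
      using assms(1)
      by (subst filterlim_tendsto_neg_mult_at_bot_iff[OF tendsto_const])
         (auto intro!: filterlim_tendsto_add_at_top[OF tendsto_const] filterlim_ident)
  qed
  then have "(\<integral>\<^sup>+ y. ennreal (C * exp (- r * (b + y))) * indicator {0..} y \<partial>lborel)
      = 0 - (- (C / r) * exp (- r * (b + 0)))"
    using assms
    by (intro nn_integral_FTC_atLeast) (auto intro!: derivative_eq_intros simp: field_simps)
  then show ?thesis by simp
qed

text \<open>The bound on the overshoot holds whatever the value of \<^term>\<open>Inf ({} :: nat set)\<close>,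
  which the library leaves unspecified.\<close>

lemma overshoot_le_of_unpassed:
  assumes "b \<ge> 0" and "\<And>n. n \<ge> 1 \<Longrightarrow> partial_sum X n \<omega> \<le> b"
  shows "overshoot X c \<omega> \<le> b - c"
proof -
  \<comment> \<open>Index 0 is included, where the sum is empty and \<open>b \<ge> 0\<close> is
    used; the bound thus applies at \<open>passage_time\<close> whatever its value.\<close>
  have "partial_sum X k \<omega> \<le> b" for k
    using assms by (cases "k = 0") (simp_all add: partial_sum_def)
  then show ?thesis
    unfolding overshoot_def by simp
qed

text \<open>If the level is passed, the infimum is attained and the overshoot is strictly positive.
  Never passing a level is thereby an event about the overshoot alone, visible in its law.\<close>

lemma overshoot_nonpos_iff:
  assumes "b \<ge> 0"
  shows "overshoot X b \<omega> \<le> 0 \<longleftrightarrow> (\<forall>n\<ge>1. partial_sum X n \<omega> \<le> b)"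
proof
  assume "overshoot X b \<omega> \<le> 0"
  show "\<forall>n\<ge>1. partial_sum X n \<omega> \<le> b"
  proof (rule ccontr)
    assume "\<not> (\<forall>n\<ge>1. partial_sum X n \<omega> \<le> b)"
    then have "{n. 1 \<le> n \<and> partial_sum X n \<omega> > b} \<noteq> {}"
      unfolding not_le not_all not_imp by blast
    then have "passage_time X b \<omega> \<in> {n. 1 \<le> n \<and> partial_sum X n \<omega> > b}"
      unfolding passage_time_def by (rule Inf_nat_def1)
    with \<open>overshoot X b \<omega> \<le> 0\<close> show False
      by (simp add: overshoot_def)
  qed
next
  assume "\<forall>n\<ge>1. partial_sum X n \<omega> \<le> b"
  then show "overshoot X b \<omega> \<le> 0"
    using overshoot_le_of_unpassed[OF assms, of X \<omega> b] by simp
qed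

lemma measurable_overshoot:
  assumes [measurable]: "\<And>i. i \<ge> 1 \<Longrightarrow> X i \<in> borel_measurable M"
  shows "overshoot X b \<in> borel_measurable M"
proof -
  have [measurable]: "partial_sum X n \<in> borel_measurable M" for n
    unfolding partial_sum_def[abs_def] by (intro borel_measurable_sum) auto
  have "passage_time X b \<in> M \<rightarrow>\<^sub>M count_space UNIV"
    \<comment> \<open>The infimum becomes a \<open>LEAST\<close> over measurable predicates; its
      countable range then allows composition with the partial sums.\<close>
    unfolding passage_time_def[abs_def] Inf_nat_def by measurable
  then have "(\<lambda>\<omega>. partial_sum X (passage_time X b \<omega>) \<omega>) \<in> borel_measurable M"
    by (rule measurable_compose_countable[where f = "partial_sum X", rotated]) fact
  then show ?thesis
    unfolding overshoot_def[abs_def] by (intro borel_measurable_diff borel_measurable_const)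
qed

lemma cdf_limiting_overshoot_law_neg:
  assumes "limiting_overshoot_law M X \<nu>" and "t < 0"
  shows "cdf \<nu> t = 0"
proof -
  interpret real_distribution \<nu>
    using assms by (simp add: limiting_overshoot_law_def)
  have "AE y in \<nu>. y \<notin> {..t}"
    using assms by (auto simp: limiting_overshoot_law_def elim!: eventually_mono)
  then show ?thesis
    unfolding cdf_def by (subst prob_eq_0) auto
qed

lemma cdf_overshoot_law_nonpos:
  assumes "prob_space M" and "\<And>i. i \<ge> 1 \<Longrightarrow> X i \<in> borel_measurable M"
    and lim: "limiting_overshoot_law M X \<nu>" and "b \<ge> 0" and "t \<le> 0"
  shows "cdf (overshoot_law M X b) t = 0"
proof -
  interpret prob_space M by fact
  have [measurable]: "overshoot X c \<in> borel_measurable M" for c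
    using assms(2) by (rule measurable_overshoot)
  have cdf_eq: "cdf (overshoot_law M X c) s = \<P>(\<omega> in M. overshoot X c \<omega> \<le> s)" for c s
    unfolding cdf_def by (subst measure_distr) (auto intro!: arg_cong[where f = prob])
  define p where "p = \<P>(\<omega> in M. overshoot X b \<omega> \<le> 0)"
  interpret N: real_distribution \<nu>
    using lim by (simp add: limiting_overshoot_law_def)
  \<comment> \<open>Weak convergence yields convergence of distribution functions only at continuity
    points. The limit law has no mass below 0, hence no atom at -1.\<close>
  have "measure \<nu> {-1} \<le> cdf \<nu> (-1)"
    unfolding cdf_def by (intro N.finite_measure_mono) auto
  also have "\<dots> = 0"
    using lim by (simp add: cdf_limiting_overshoot_law_neg)
  finally have "isCont (cdf \<nu>) (-1)"
    by (simp add: N.isCont_cdf measure_le_0_iff)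
  moreover have "weak_conv_m (\<lambda>n. overshoot_law M X (real n)) \<nu>"
    using lim filterlim_real_sequentially
    by (simp add: limiting_overshoot_law_def weak_limit_at_top_def)
  ultimately have "(\<lambda>n. cdf (overshoot_law M X (real n)) (-1)) \<longlonglongrightarrow> cdf \<nu> (-1)"
    by (simp add: weak_conv_m_def weak_conv_def)
  moreover have "\<forall>\<^sub>F n in sequentially. p \<le> cdf (overshoot_law M X (real n)) (-1)"
    \<comment> \<open>From \<open>n \<ge> b + 1\<close> on, a walk that stays below \<open>b\<close>
      has formal overshoot at most \<open>b - n \<le> -1\<close> at level \<open>n\<close>.\<close>
    using eventually_ge_at_top[of "nat \<lceil>b + 1\<rceil>"]
  proof eventually_elim
    case (elim n)
    then have n: "b - real n \<le> -1" by linarith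
    have "overshoot X (real n) \<omega> \<le> -1" if "overshoot X b \<omega> \<le> 0" for \<omega>
    proof -
      have "\<forall>k\<ge>1. partial_sum X k \<omega> \<le> b"
        using that by (simp only: overshoot_nonpos_iff[OF \<open>b \<ge> 0\<close>])
      then have "overshoot X (real n) \<omega> \<le> b - real n"
        using \<open>b \<ge> 0\<close> by (intro overshoot_le_of_unpassed) auto
      with n show ?thesis by linarith
    qed
    then show ?case
      unfolding p_def cdf_eq by (intro finite_measure_mono) auto
  qed
  ultimately have "p \<le> cdf \<nu> (-1)"
    by (rule tendsto_lowerbound) simp
  also have "\<dots> = 0"
    using lim by (simp add: cdf_limiting_overshoot_law_neg)
  finally have "p \<le> 0" .
  moreover have "cdf (overshoot_law M X b) t \<le> p"
    unfolding cdf_eq p_def using \<open>t \<le> 0\<close> by (intro finite_measure_mono) auto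
  moreover have "cdf (overshoot_law M X b) t \<ge> 0"
    by (simp add: cdf_def)
  ultimately show ?thesis by linarith
qed

theorem proposition3:
  fixes F0 :: "real measure" and \<theta>max :: ereal
    and P :: "real \<Rightarrow> 'a measure" and X :: "nat \<Rightarrow> 'a \<Rightarrow> real"
    and Rinf :: "real \<Rightarrow> real measure"
    and C r \<theta>star b :: real
  assumes "standard_exp_family F0 \<theta>max"
    and "\<And>\<theta>. \<theta> \<in> parameter_set \<theta>max \<Longrightarrow> iid_with_law (P \<theta>) X (exp_tilt F0 \<theta>)"
    and "\<And>\<theta>. \<theta> \<in> parameter_set \<theta>max \<Longrightarrow> limiting_overshoot_law (P \<theta>) X (Rinf \<theta>)"
    and "C > 0" and "r > 0" and "\<theta>star > 0" and "{0..\<theta>star} \<subseteq> parameter_set \<theta>max"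
    and "\<And>b y. b > 0 \<Longrightarrow> y > 0 \<Longrightarrow>
           (SUP \<theta>\<in>{0..\<theta>star}. \<bar>\<P>(\<omega> in P \<theta>. overshoot X b \<omega> \<le> y) - \<P>(z in Rinf \<theta>. z \<le> y)\<bar>)
             \<le> C * exp (- r * (b + y))"
    and "b > 0"
  shows "(SUP \<theta>\<in>{0..\<theta>star}. W1 (overshoot_law (P \<theta>) X b) (Rinf \<theta>))
           \<le> ennreal (C / r * exp (- r * b))"
proof (rule SUP_least)
  fix \<theta> assume \<theta>: "\<theta> \<in> {0..\<theta>star}"
  have fam: "iid_with_law (P \<theta>') X (exp_tilt F0 \<theta>')" "limiting_overshoot_law (P \<theta>') X (Rinf \<theta>')"
    if "\<theta>' \<in> {0..\<theta>star}" for \<theta>'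
    using assms(2,3,7) that by blast+
  have P: "prob_space (P \<theta>')" "prob_space (Rinf \<theta>')" if "\<theta>' \<in> {0..\<theta>star}" for \<theta>'
    using fam[OF that]
    by (auto simp: iid_with_law_def limiting_overshoot_law_def real_distribution_def)
  interpret prob_space "P \<theta>" using \<theta> by (rule P)
  have X: "X i \<in> borel_measurable (P \<theta>)" if "i \<ge> 1" for i
    using fam(1)[OF \<theta>] that by (auto simp: iid_with_law_def indep_vars_def)
  have R [measurable]: "overshoot X b \<in> borel_measurable (P \<theta>)"
    using X by (rule measurable_overshoot)
  interpret N: real_distribution "Rinf \<theta>"
    using fam(2)[OF \<theta>] by (simp add: limiting_overshoot_law_def)
  let ?F = "cdf (overshoot_law (P \<theta>) X b)" and ?G = "cdf (Rinf \<theta>)"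
  have pos: "\<bar>?F y - ?G y\<bar> \<le> C * exp (- r * (b + y))" if "y > 0" for y
  proof -
    let ?d = "\<lambda>\<theta>. \<bar>\<P>(\<omega> in P \<theta>. overshoot X b \<omega> \<le> y) - \<P>(z in Rinf \<theta>. z \<le> y)\<bar>"
    \<comment> \<open>The supremum in the hypothesis is one of reals, so it dominates its members
      only once the family is known to be bounded above.\<close>
    have "?d \<theta>' \<le> 1" if "\<theta>' \<in> {0..\<theta>star}" for \<theta>'
      using prob_space.prob_le_1[OF P(1)[OF that]] prob_space.prob_le_1[OF P(2)[OF that]]
      by (smt (verit) measure_nonneg)
    then have "?d \<theta> \<le> (SUP \<theta>\<in>{0..\<theta>star}. ?d \<theta>)"
      using \<theta> by (intro cSUP_upper bdd_aboveI2[where M = 1])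
    also have "\<dots> \<le> C * exp (- r * (b + y))"
      using assms(8,9) that by blast
    also have "\<P>(\<omega> in P \<theta>. overshoot X b \<omega> \<le> y) = ?F y"
      unfolding cdf_def by (subst measure_distr) (auto intro!: arg_cong[where f = prob])
    also have "\<P>(z in Rinf \<theta>. z \<le> y) = ?G y"
      by (simp add: cdf_def atMost_def)
    finally show ?thesis .
  qed
  have neg: "?F y = 0" "?G y = 0" if "y < 0" for y
  proof -
    show "?F y = 0"
      using \<open>b > 0\<close> that
      by (intro cdf_overshoot_law_nonpos[OF prob_space_axioms X fam(2)[OF \<theta>]]) auto
    show "?G y = 0"
      using fam(2)[OF \<theta>] that by (rule cdf_limiting_overshoot_law_neg)
  qed
  have "W1 (overshoot_law (P \<theta>) X b) (Rinf \<theta>) \<le> (\<integral>\<^sup>+ y. ennreal \<bar>?F y - ?G y\<bar> \<partial>lborel)"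
    by (intro W1_le_nn_integral_cdf real_distribution_distr R N.real_distribution_axioms)
  also have "\<dots> \<le> (\<integral>\<^sup>+ y. ennreal (C * exp (- r * (b + y))) * indicator {0..} y \<partial>lborel)"
  proof (rule nn_integral_mono_AE)
    \<comment> \<open>The estimate covers \<open>y > 0\<close> and both functions vanish for
      \<open>y < 0\<close>; the remaining point 0 is null.\<close>
    show "AE y in lborel. ennreal \<bar>?F y - ?G y\<bar>
        \<le> ennreal (C * exp (- r * (b + y))) * indicator {0..} y"
      using AE_lborel_singleton[of 0]
    proof eventually_elim
      case (elim y)
      then show ?case
        using pos[of y] neg[of y] by (cases "y < 0") (auto intro!: ennreal_leI)
    qed
  qed
  also have "\<dots> = ennreal (C / r * exp (- r * b))"
    using assms(4,5) by (intro nn_integral_exp_neg_tail) auto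
  finally show "W1 (overshoot_law (P \<theta>) X b) (Rinf \<theta>) \<le> ennreal (C / r * exp (- r * b))" .
qed

end
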